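(* The assignments $\mathbf{L}\mapsto\mathbf{R}(\mathbf{L})$ (from orthomodular lattices to orthomodular near semirings) and $\mathbf{R}\mapsto\mathbf{L}(\mathbf{R})$ (from orthomodular near semirings to orthomodular lattices) are mutually inverse: $\mathbf{L}=\mathbf{L}(\mathbf{R}(\mathbf{L}))$ for every orthomodular lattice $\mathbf{L}$, and $\mathbf{R}=\mathbf{R}(\mathbf{L}(\mathbf{R}))$ for every orthomodular near semiring $\mathbf{R}$ (equality of all operations on the same universe).
   Context: A near semiring is an algebra $\langle R,+,\cdot,0,1\rangle$ such that: (i) $\langle R,+,0\rangle$ is a commutative monoid; (ii) $x\cdot 1=x=1\cdot x$ (multiplication need not be associative or commutative); (iii) $(x+y)\cdot z=(x\cdot z)+(y\cdot z)$; (iv) $x\cdot 0=0\cdot x=0$. It is idempotent if $x+x=x$; then $x\le y$ iff $x+y=y$ defines a partial order, called the induced order. An involutive near semiring is an idempotent near semiring with a map $\alpha:R\to R$ such that $\alpha(\alpha(x))=x$, and $x\le y$ implies $\alpha(y)\le\alpha(x)$. A Łukasiewicz near semiring is an involutive near semiring satisfying the identity $\alpha(x\cdot\alpha(y))\cdot\alpha(y)=\alpha(y\cdot\alpha(x))\cdot\alpha(x)$. An orthomodular near semiring is a Łukasiewicz near semiring satisfying the identity $x=x\cdot(x+y)$. An orthomodular lattice is an algebra $\langle L,\vee,\wedge,{}',0,1\rangle$ such that $\langle L,\vee,\wedge,0,1\rangle$ is a bounded lattice, $x\wedge x'=0$, $x\vee x'=1$, $x''=x$, $x\le y$ implies $y'\le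 x'$, and $x\le y$ implies $y=x\vee(y\wedge x')$. For an orthomodular lattice $\mathbf{L}$, $\mathbf{R}(\mathbf{L})=\langle L,+,\cdot,{}',0,1\rangle$ where $x+y=x\vee y$, $x\cdot y=(x\vee y')\wedge y$ and $\alpha(x)=x'$; it is an orthomodular near semiring. For an orthomodular near semiring $\mathbf{R}=\langle R,+,\cdot,0,1,\alpha\rangle$, $\mathbf{L}(\mathbf{R})=\langle R,\vee,\wedge,{}',0,1\rangle$ where $x\vee y=x+y$, $x'=\alpha(x)$, $x\wedge y=(x'\vee y')'$; it is an orthomodular lattice. *)

theory Defs
  imports "HOL-Algebra.Ring"
begin

record 'a inv_ring = "'a ring" +
  invol :: "'a \<Rightarrow> 'a" ("\<alpha>\<index>")

text \<open>Multiplication need not be associative or commutative, and only the right distributive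
  law is required.\<close>

locale near_semiring = abelian_monoid R for R (structure) +
  assumes m_closed [intro, simp]:
      "\<lbrakk> x \<in> carrier R; y \<in> carrier R \<rbrakk> \<Longrightarrow> x \<otimes> y \<in> carrier R"
    and one_closed [intro, simp]: "\<one> \<in> carrier R"
    and l_one: "x \<in> carrier R \<Longrightarrow> \<one> \<otimes> x = x"
    and r_one: "x \<in> carrier R \<Longrightarrow> x \<otimes> \<one> = x"
    and l_distr: "\<lbrakk> x \<in> carrier R; y \<in> carrier R; z \<in> carrier R \<rbrakk>
      \<Longrightarrow> (x \<oplus> y) \<otimes> z = (x \<otimes> z) \<oplus> (y \<otimes> z)"
    and l_null: "x \<in> carrier R \<Longrightarrow> \<zero> \<otimes> x = \<zero>"
    and r_null: "x \<in> carrier R \<Longrightarrow> x \<otimes> \<zero> = \<zero>"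

locale idempotent_near_semiring = near_semiring R for R (structure) +
  assumes add_idem: "x \<in> carrier R \<Longrightarrow> x \<oplus> x = x"

definition induced_le :: "('a, 'm) ring_scheme \<Rightarrow> 'a \<Rightarrow> 'a \<Rightarrow> bool" (infix "\<preceq>\<index>" 50) where
  "x \<preceq>\<^bsub>R\<^esub> y \<longleftrightarrow> x \<oplus>\<^bsub>R\<^esub> y = y"

locale involutive_near_semiring = idempotent_near_semiring R for R (structure) +
  assumes invol_closed [intro, simp]: "x \<in> carrier R \<Longrightarrow> \<alpha> x \<in> carrier R"
    and invol_invol: "x \<in> carrier R \<Longrightarrow> \<alpha> (\<alpha> x) = x"
    and invol_antitone: "\<lbrakk> x \<in> carrier R; y \<in> carrier R; x \<preceq> y \<rbrakk> \<Longrightarrow> \<alpha> y \<preceq> \<alpha> x"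

locale lukasiewicz_near_semiring = involutive_near_semiring R for R (structure) +
  assumes lukasiewicz: "\<lbrakk> x \<in> carrier R; y \<in> carrier R \<rbrakk>
      \<Longrightarrow> \<alpha> (x \<otimes> \<alpha> y) \<otimes> \<alpha> y = \<alpha> (y \<otimes> \<alpha> x) \<otimes> \<alpha> x"

locale orthomodular_near_semiring = lukasiewicz_near_semiring R for R (structure) +
  assumes mult_add_absorb: "\<lbrakk> x \<in> carrier R; y \<in> carrier R \<rbrakk> \<Longrightarrow> x = x \<otimes> (x \<oplus> y)"

text \<open>Lattices are treated here as algebras, so the order is derived from the join; the
  order-based lattices of HOL-Algebra have the order relation as primitive.\<close>

record 'a ortholattice_alg = "'a partial_object" +
  ljoin :: "'a \<Rightarrow> 'a \<Rightarrow> 'a" (infixl "\<curlyvee>\<index>" 65)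
  lmeet :: "'a \<Rightarrow> 'a \<Rightarrow> 'a" (infixl "\<curlywedge>\<index>" 70)
  lcompl :: "'a \<Rightarrow> 'a" ("\<sim>\<index> _" [81] 80)
  lzero :: 'a ("\<^bold>0\<index>")
  lone :: 'a ("\<^bold>1\<index>")

definition lattice_le :: "('a, 'm) ortholattice_alg_scheme \<Rightarrow> 'a \<Rightarrow> 'a \<Rightarrow> bool"
    (infix "\<unlhd>\<index>" 50) where
  "x \<unlhd>\<^bsub>L\<^esub> y \<longleftrightarrow> x \<curlyvee>\<^bsub>L\<^esub> y = y"

locale bounded_lattice_alg =
  fixes L (structure)
  assumes join_closed [intro, simp]:
      "\<lbrakk> x \<in> carrier L; y \<in> carrier L \<rbrakk> \<Longrightarrow> x \<curlyvee> y \<in> carrier L"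
    and meet_closed [intro, simp]:
      "\<lbrakk> x \<in> carrier L; y \<in> carrier L \<rbrakk> \<Longrightarrow> x \<curlywedge> y \<in> carrier L"
    and zero_closed [intro, simp]: "\<^bold>0 \<in> carrier L"
    and one_closed [intro, simp]: "\<^bold>1 \<in> carrier L"
    and join_assoc: "\<lbrakk> x \<in> carrier L; y \<in> carrier L; z \<in> carrier L \<rbrakk>
      \<Longrightarrow> (x \<curlyvee> y) \<curlyvee> z = x \<curlyvee> (y \<curlyvee> z)"
    and meet_assoc: "\<lbrakk> x \<in> carrier L; y \<in> carrier L; z \<in> carrier L \<rbrakk>
      \<Longrightarrow> (x \<curlywedge> y) \<curlywedge> z = x \<curlywedge> (y \<curlywedge> z)"
    and join_comm: "\<lbrakk> x \<in> carrier L; y \<in> carrier L \<rbrakk> \<Longrightarrow> x \<curlyvee> y = y \<curlyvee> x"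
    and meet_comm: "\<lbrakk> x \<in> carrier L; y \<in> carrier L \<rbrakk> \<Longrightarrow> x \<curlywedge> y = y \<curlywedge> x"
    and join_meet_absorb: "\<lbrakk> x \<in> carrier L; y \<in> carrier L \<rbrakk> \<Longrightarrow> x \<curlyvee> (x \<curlywedge> y) = x"
    and meet_join_absorb: "\<lbrakk> x \<in> carrier L; y \<in> carrier L \<rbrakk> \<Longrightarrow> x \<curlywedge> (x \<curlyvee> y) = x"
    and zero_least: "x \<in> carrier L \<Longrightarrow> \<^bold>0 \<unlhd> x"
    and one_greatest: "x \<in> carrier L \<Longrightarrow> x \<unlhd> \<^bold>1"

locale orthomodular_lattice = bounded_lattice_alg L for L (structure) +
  assumes compl_closed [intro, simp]: "x \<in> carrier L \<Longrightarrow> \<sim> x \<in> carrier L"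
    and meet_compl: "x \<in> carrier L \<Longrightarrow> x \<curlywedge> \<sim> x = \<^bold>0"
    and join_compl: "x \<in> carrier L \<Longrightarrow> x \<curlyvee> \<sim> x = \<^bold>1"
    and compl_compl: "x \<in> carrier L \<Longrightarrow> \<sim> (\<sim> x) = x"
    and compl_antitone: "\<lbrakk> x \<in> carrier L; y \<in> carrier L; x \<unlhd> y \<rbrakk> \<Longrightarrow> \<sim> y \<unlhd> \<sim> x"
    and orthomodular: "\<lbrakk> x \<in> carrier L; y \<in> carrier L; x \<unlhd> y \<rbrakk>
      \<Longrightarrow> y = x \<curlyvee> (y \<curlywedge> \<sim> x)"

definition near_semiring_of :: "'a ortholattice_alg \<Rightarrow> 'a inv_ring" where
  "near_semiring_of L =
    \<lparr> carrier = carrier L,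
      monoid.mult = (\<lambda>x y. (x \<curlyvee>\<^bsub>L\<^esub> \<sim>\<^bsub>L\<^esub> y) \<curlywedge>\<^bsub>L\<^esub> y),
      one = \<^bold>1\<^bsub>L\<^esub>,
      zero = \<^bold>0\<^bsub>L\<^esub>,
      add = (\<lambda>x y. x \<curlyvee>\<^bsub>L\<^esub> y),
      invol = (\<lambda>x. \<sim>\<^bsub>L\<^esub> x) \<rparr>"

definition lattice_of :: "'a inv_ring \<Rightarrow> 'a ortholattice_alg" where
  "lattice_of R =
    \<lparr> carrier = carrier R,
      ljoin = (\<lambda>x y. x \<oplus>\<^bsub>R\<^esub> y),
      lmeet = (\<lambda>x y. \<alpha>\<^bsub>R\<^esub> (\<alpha>\<^bsub>R\<^esub> x \<oplus>\<^bsub>R\<^esub> \<alpha>\<^bsub>R\<^esub> y)),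
      lcompl = (\<lambda>x. \<alpha>\<^bsub>R\<^esub> x),
      lzero = \<zero>\<^bsub>R\<^esub>,
      lone = \<one>\<^bsub>R\<^esub> \<rparr>"

text \<open>An algebra is determined by its carrier and the values of its operations on the carrier.
  Equality of records would also compare the irrelevant values outside the carrier.\<close>

definition same_lattice :: "'a ortholattice_alg \<Rightarrow> 'a ortholattice_alg \<Rightarrow> bool" where
  "same_lattice L M \<longleftrightarrow>
    carrier L = carrier M \<and>
    (\<forall>x \<in> carrier L. \<forall>y \<in> carrier L. x \<curlyvee>\<^bsub>L\<^esub> y = x \<curlyvee>\<^bsub>M\<^esub> y) \<and>
    (\<forall>x \<in> carrier L. \<forall>y \<in> carrier L. x \<curlywedge>\<^bsub>L\<^esub> y = x \<curlywedge>\<^bsub>M\<^esub> y) \<and>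
    (\<forall>x \<in> carrier L. \<sim>\<^bsub>L\<^esub> x = \<sim>\<^bsub>M\<^esub> x) \<and>
    \<^bold>0\<^bsub>L\<^esub> = \<^bold>0\<^bsub>M\<^esub> \<and> \<^bold>1\<^bsub>L\<^esub> = \<^bold>1\<^bsub>M\<^esub>"

definition same_near_semiring :: "'a inv_ring \<Rightarrow> 'a inv_ring \<Rightarrow> bool" where
  "same_near_semiring R S \<longleftrightarrow>
    carrier R = carrier S \<and>
    (\<forall>x \<in> carrier R. \<forall>y \<in> carrier R. x \<oplus>\<^bsub>R\<^esub> y = x \<oplus>\<^bsub>S\<^esub> y) \<and>
    (\<forall>x \<in> carrier R. \<forall>y \<in> carrier R. x \<otimes>\<^bsub>R\<^esub> y = x \<otimes>\<^bsub>S\<^esub> y) \<and>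
    (\<forall>x \<in> carrier R. \<alpha>\<^bsub>R\<^esub> x = \<alpha>\<^bsub>S\<^esub> x) \<and>
    \<zero>\<^bsub>R\<^esub> = \<zero>\<^bsub>S\<^esub> \<and> \<one>\<^bsub>R\<^esub> = \<one>\<^bsub>S\<^esub>"

end

theory Submission
  imports Defs
begin

text \<open>In an orthomodular lattice the product \<open>(x \<or> y') \<and> y\<close> is the Sasaki projection onto \<open>y\<close>. It fixes
  every element below \<open>y\<close>, which gives both \<open>x = x \<cdot> (x + y)\<close> and right distributivity: each
  \<open>x \<or> z'\<close> splits as \<open>z' \<or> x \<cdot> z\<close>. Conversely, in an orthomodular near semiring both sides of
  the Lukasiewicz identity equal \<open>\<alpha> (x + y)\<close>, so that \<open>x \<and> y = \<alpha> (\<alpha> x \<cdot> y) \<cdot> y\<close>. Since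
  \<open>u \<cdot> y = u\<close> for \<open>u \<le> y\<close>, two applications of this formula yield
  \<open>(x \<or> y') \<and> y = x \<cdot> y\<close>, and hence the orthomodular law.\<close>

section \<open>Orthomodular lattices: De Morgan laws and the Sasaki projection\<close>

context orthomodular_lattice
begin

lemma join_left_comm:
  "\<lbrakk> x \<in> carrier L; y \<in> carrier L; z \<in> carrier L \<rbrakk> \<Longrightarrow> x \<curlyvee> (y \<curlyvee> z) = y \<curlyvee> (x \<curlyvee> z)"
  by (metis join_assoc join_comm)

lemmas join_ac = join_assoc join_comm join_left_comm

lemma join_idem: "x \<in> carrier L \<Longrightarrow> x \<curlyvee> x = x"
  by (metis join_meet_absorb meet_join_absorb join_closed)

lemma join_absorb: "\<lbrakk> x \<in> carrier L; y \<in> carrier L \<rbrakk> \<Longrightarrow> x \<curlyvee> (x \<curlyvee> y) = x \<curlyvee> y"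
  by (metis join_assoc join_idem)

lemma zero_join: "x \<in> carrier L \<Longrightarrow> \<^bold>0 \<curlyvee> x = x"
  using zero_least unfolding lattice_le_def .

lemma join_zero: "x \<in> carrier L \<Longrightarrow> x \<curlyvee> \<^bold>0 = x"
  by (simp add: zero_join join_comm[of x])

lemma join_one: "x \<in> carrier L \<Longrightarrow> x \<curlyvee> \<^bold>1 = \<^bold>1"
  using one_greatest unfolding lattice_le_def by blast

lemma meet_zero: "x \<in> carrier L \<Longrightarrow> x \<curlywedge> \<^bold>0 = \<^bold>0"
  by (metis join_comm join_meet_absorb join_zero meet_closed meet_comm zero_closed)

lemma meet_one: "x \<in> carrier L \<Longrightarrow> x \<curlywedge> \<^bold>1 = x"
  by (metis join_one meet_join_absorb one_closed)

lemma le_join: "\<lbrakk> x \<in> carrier L; y \<in> carrier L \<rbrakk> \<Longrightarrow> x \<unlhd> x \<curlyvee> y"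
  unfolding lattice_le_def by (metis join_assoc join_idem)

lemma meet_le: "\<lbrakk> x \<in> carrier L; y \<in> carrier L \<rbrakk> \<Longrightarrow> x \<curlywedge> y \<unlhd> y"
  unfolding lattice_le_def by (metis join_comm join_meet_absorb meet_closed meet_comm)

lemma le_iff_meet: "\<lbrakk> x \<in> carrier L; y \<in> carrier L \<rbrakk> \<Longrightarrow> x \<unlhd> y \<longleftrightarrow> x \<curlywedge> y = x"
  unfolding lattice_le_def by (metis join_comm join_meet_absorb meet_comm meet_join_absorb)

lemma join_le:
  "\<lbrakk> x \<in> carrier L; y \<in> carrier L; z \<in> carrier L; x \<unlhd> z; y \<unlhd> z \<rbrakk> \<Longrightarrow> x \<curlyvee> y \<unlhd> z"
  unfolding lattice_le_def by (metis join_assoc)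

lemma le_meet:
  "\<lbrakk> x \<in> carrier L; y \<in> carrier L; z \<in> carrier L; z \<unlhd> x; z \<unlhd> y \<rbrakk> \<Longrightarrow> z \<unlhd> x \<curlywedge> y"
  by (metis le_iff_meet meet_assoc meet_closed)

lemma le_antisym: "\<lbrakk> x \<in> carrier L; y \<in> carrier L; x \<unlhd> y; y \<unlhd> x \<rbrakk> \<Longrightarrow> x = y"
  unfolding lattice_le_def by (metis join_comm)

lemma compl_join:
  assumes [simp]: "x \<in> carrier L" "y \<in> carrier L"
  shows "\<sim> (x \<curlyvee> y) = \<sim> x \<curlywedge> \<sim> y"
proof (rule le_antisym)
  have "y \<unlhd> x \<curlyvee> y"
    using le_join[of y x] by (simp add: join_comm)
  then show "\<sim> (x \<curlyvee> y) \<unlhd> \<sim> x \<curlywedge> \<sim> y"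
    by (simp add: compl_antitone le_join le_meet)
  have "\<sim> x \<curlywedge> \<sim> y \<unlhd> \<sim> x" "\<sim> x \<curlywedge> \<sim> y \<unlhd> \<sim> y"
    using meet_le[of "\<sim> y" "\<sim> x"] by (simp_all add: meet_le meet_comm)
  then have "x \<unlhd> \<sim> (\<sim> x \<curlywedge> \<sim> y)" "y \<unlhd> \<sim> (\<sim> x \<curlywedge> \<sim> y)"
    by (metis assms compl_antitone compl_closed compl_compl meet_closed)+
  then have "x \<curlyvee> y \<unlhd> \<sim> (\<sim> x \<curlywedge> \<sim> y)"
    by (simp add: join_le)
  then show "\<sim> x \<curlywedge> \<sim> y \<unlhd> \<sim> (x \<curlyvee> y)"
    by (metis assms compl_antitone compl_closed compl_compl join_closed meet_closed)
qed simp_all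

lemma compl_meet:
  "\<lbrakk> x \<in> carrier L; y \<in> carrier L \<rbrakk> \<Longrightarrow> \<sim> (x \<curlywedge> y) = \<sim> x \<curlyvee> \<sim> y"
  by (metis compl_closed compl_compl compl_join join_closed)

text \<open>This is the orthomodular law for \<open>\<sim> y \<unlhd> \<sim> x\<close>, complemented
  by De Morgan.\<close>

lemma sasaki_fixes:
  assumes [simp]: "x \<in> carrier L" "y \<in> carrier L" and "x \<unlhd> y"
  shows "(x \<curlyvee> \<sim> y) \<curlywedge> y = x"
proof -
  have "\<sim> x = \<sim> y \<curlyvee> (\<sim> x \<curlywedge> \<sim> (\<sim> y))"
    using assms by (intro orthomodular) (simp_all add: compl_antitone)
  then have "\<sim> (\<sim> x) = \<sim> (\<sim> y) \<curlywedge> \<sim> (\<sim> x \<curlywedge> \<sim> (\<sim> y))"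
    by (metis assms(1,2) compl_closed compl_join meet_closed)
  then show ?thesis
    by (simp add: compl_compl compl_meet meet_comm join_comm)
qed

lemma sasaki_join:
  assumes [simp]: "x \<in> carrier L" "y \<in> carrier L" "z \<in> carrier L"
  shows "((x \<curlyvee> y) \<curlyvee> \<sim> z) \<curlywedge> z = ((x \<curlyvee> \<sim> z) \<curlywedge> z) \<curlyvee> ((y \<curlyvee> \<sim> z) \<curlywedge> z)"
proof -
  \<comment> \<open>The orthomodular law for
    \<open>\<sim> z \<unlhd> u \<curlyvee> \<sim> z\<close>.\<close>
  have split: "u \<curlyvee> \<sim> z = \<sim> z \<curlyvee> ((u \<curlyvee> \<sim> z) \<curlywedge> z)" if [simp]: "u \<in> carrier L" for u
    using orthomodular[of "\<sim> z" "u \<curlyvee> \<sim> z"] le_join[of "\<sim> z" u]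
    by (simp add: join_comm compl_compl)
  define c where "c = (x \<curlyvee> \<sim> z) \<curlywedge> z"
  define d where "d = (y \<curlyvee> \<sim> z) \<curlywedge> z"
  have [simp]: "c \<in> carrier L" "d \<in> carrier L"
    by (simp_all add: c_def d_def)
  have "c \<curlyvee> d \<unlhd> z"
    by (rule join_le) (simp_all add: c_def d_def meet_le)
  \<comment> \<open>The argument of the projection is rewritten as
    \<open>(c \<curlyvee> d) \<curlyvee> \<sim> z\<close>; as \<open>c \<curlyvee> d\<close> lies
    below \<open>z\<close>, the projection fixes it.\<close>
  have "(x \<curlyvee> y) \<curlyvee> \<sim> z = (x \<curlyvee> \<sim> z) \<curlyvee> (y \<curlyvee> \<sim> z)"
    by (simp add: join_ac join_absorb join_idem)
  also have "\<dots> = (\<sim> z \<curlyvee> c) \<curlyvee> (\<sim> z \<curlyvee> d)"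
    using split[of x] split[of y] by (simp add: c_def d_def)
  also have "\<dots> = (c \<curlyvee> d) \<curlyvee> \<sim> z"
    by (simp add: join_ac join_absorb join_idem)
  finally show ?thesis
    using sasaki_fixes[OF _ _ \<open>c \<curlyvee> d \<unlhd> z\<close>] by (simp add: c_def d_def)
qed

text \<open>One side of the Lukasiewicz identity takes a value symmetric in \<open>x\<close> and
  \<open>y\<close>, which settles the identity. By De Morgan the inner projection contributes only
  \<open>\<sim> (x \<curlyvee> y)\<close>, an element below \<open>\<sim> y\<close>.\<close>

lemma sasaki_lukasiewicz:
  assumes [simp]: "x \<in> carrier L" "y \<in> carrier L"
  shows "(\<sim> ((x \<curlyvee> \<sim> (\<sim> y)) \<curlywedge> \<sim> y) \<curlyvee> \<sim> (\<sim> y)) \<curlywedge> \<sim> y = \<sim> (x \<curlyvee> y)"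
proof -
  have "y \<unlhd> x \<curlyvee> y"
    using le_join[of y x] by (simp add: join_comm)
  then have "(\<sim> (x \<curlyvee> y) \<curlyvee> \<sim> (\<sim> y)) \<curlywedge> \<sim> y = \<sim> (x \<curlyvee> y)"
    by (intro sasaki_fixes) (simp_all add: compl_antitone)
  then show ?thesis
    by (simp add: compl_compl compl_meet join_assoc join_idem)
qed

end

theorem orthomodular_near_semiring_of:
  fixes L :: "'a ortholattice_alg" (structure)
  assumes "orthomodular_lattice L"
  shows "orthomodular_near_semiring (near_semiring_of L)"
proof -
  interpret orthomodular_lattice L by fact
  have right_zero: "(x \<curlyvee> \<sim> \<^bold>0) \<curlywedge> \<^bold>0 = \<^bold>0" if "x \<in> carrier L" for x
    using that by (simp add: meet_zero)
  have left_zero: "(\<^bold>0 \<curlyvee> \<sim> x) \<curlywedge> x = \<^bold>0" if "x \<in> carrier L" for x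
    using that by (simp add: sasaki_fixes zero_least)
  have left_one: "(\<^bold>1 \<curlyvee> \<sim> x) \<curlywedge> x = x" if "x \<in> carrier L" for x
    using that by (metis compl_closed join_comm join_one meet_comm meet_one one_closed)
  have right_one: "(x \<curlyvee> \<sim> \<^bold>1) \<curlywedge> \<^bold>1 = x" if "x \<in> carrier L" for x
    using that by (simp add: sasaki_fixes one_greatest)
  have antitone: "\<sim> y \<curlyvee> \<sim> x = \<sim> x"
    if "x \<in> carrier L" "y \<in> carrier L" "x \<curlyvee> y = y" for x y
    using that compl_antitone[of x y] by (simp add: lattice_le_def)
  have luk: "(\<sim> ((x \<curlyvee> \<sim> (\<sim> y)) \<curlywedge> \<sim> y) \<curlyvee> \<sim> (\<sim> y)) \<curlywedge> \<sim> y
      = (\<sim> ((y \<curlyvee> \<sim> (\<sim> x)) \<curlywedge> \<sim> x) \<curlyvee> \<sim> (\<sim> x)) \<curlywedge> \<sim> x"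
    if "x \<in> carrier L" "y \<in> carrier L" for x y
    using that by (simp only: sasaki_lukasiewicz join_comm)
  have absorb: "x = (x \<curlyvee> \<sim> (x \<curlyvee> y)) \<curlywedge> (x \<curlyvee> y)"
    if "x \<in> carrier L" "y \<in> carrier L" for x y
    using that by (simp add: sasaki_fixes le_join)
  show ?thesis
    by (unfold_locales; simp add: near_semiring_of_def induced_le_def;
        fact join_assoc join_comm zero_join join_zero join_idem right_zero left_zero left_one
          right_one sasaki_join antitone luk absorb compl_compl)
qed

text \<open>Only the meet is redefined on the way, and De Morgan recovers it.\<close>

theorem same_lattice_of_near_semiring_of:
  assumes "orthomodular_lattice L"
  shows "same_lattice L (lattice_of (near_semiring_of L))"
proof -
  interpret orthomodular_lattice L by fact
  show ?thesis
    by (simp add: same_lattice_def lattice_of_def near_semiring_of_def compl_join compl_compl)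
qed

section \<open>Orthomodular near semirings: the product as a Sasaki projection\<close>

context orthomodular_near_semiring
begin

lemma one_add: "x \<in> carrier R \<Longrightarrow> \<one> \<oplus> x = \<one>"
  using mult_add_absorb[of \<one> x] by (simp add: l_one)

lemma invol_zero: "\<alpha> \<zero> = \<one>"
proof -
  \<comment> \<open>From \<open>\<zero> \<preceq> \<alpha> \<one>\<close> one gets
    \<open>\<one> \<preceq> \<alpha> \<zero>\<close>, and \<open>\<one>\<close> is the top
    element.\<close>
  have "\<alpha> (\<alpha> \<one>) \<preceq> \<alpha> \<zero>"
    by (rule invol_antitone) (simp_all add: induced_le_def)
  then show ?thesis
    by (simp add: induced_le_def invol_invol one_add)
qed

lemma invol_one: "\<alpha> \<one> = \<zero>"
  by (metis invol_invol invol_zero zero_closed)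

lemma add_le: "\<lbrakk> x \<in> carrier R; y \<in> carrier R \<rbrakk> \<Longrightarrow> x \<preceq> x \<oplus> y"
  by (simp add: induced_le_def a_assoc[symmetric] add_idem)

lemma mult_fixes: "\<lbrakk> x \<in> carrier R; y \<in> carrier R; x \<preceq> y \<rbrakk> \<Longrightarrow> x \<otimes> y = x"
  by (metis induced_le_def mult_add_absorb)

text \<open>Multiply \<open>\<one> \<oplus> x = \<one>\<close> by \<open>y\<close> on the
  right.\<close>

lemma mult_le: "\<lbrakk> x \<in> carrier R; y \<in> carrier R \<rbrakk> \<Longrightarrow> x \<otimes> y \<preceq> y"
  using l_distr[of \<one> x y] by (simp add: induced_le_def one_add l_one a_comm[of "x \<otimes> y"])

text \<open>With \<open>\<one>\<close> as its first argument, the Lukasiewicz identity has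
  \<open>x \<otimes> \<alpha> x\<close> on the left and a product with \<open>\<zero>\<close> on the
  right.\<close>

lemma mult_invol:
  assumes [simp]: "x \<in> carrier R" shows "x \<otimes> \<alpha> x = \<zero>"
  using lukasiewicz[of \<one> x] by (simp add: l_one invol_one r_null invol_invol)

lemma lukasiewicz_eq_invol_add:
  assumes [simp]: "x \<in> carrier R" "y \<in> carrier R"
  shows "\<alpha> (x \<otimes> \<alpha> y) \<otimes> \<alpha> y = \<alpha> (x \<oplus> y)"
proof -
  \<comment> \<open>Adding \<open>y\<close> to \<open>x\<close> is harmless because
    \<open>y \<otimes> \<alpha> y = \<zero>\<close>; swapping the arguments then brings in
    \<open>\<alpha> (x \<oplus> y)\<close>.\<close>
  have "\<alpha> (x \<otimes> \<alpha> y) \<otimes> \<alpha> y = \<alpha> ((x \<oplus> y) \<otimes> \<alpha> y) \<otimes> \<alpha> y"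
    by (simp add: l_distr mult_invol)
  also have "\<dots> = \<alpha> (y \<otimes> \<alpha> (x \<oplus> y)) \<otimes> \<alpha> (x \<oplus> y)"
    by (rule lukasiewicz) simp_all
  also have "y \<otimes> \<alpha> (x \<oplus> y) = \<zero>"
  proof -
    have "\<zero> = (y \<oplus> x) \<otimes> \<alpha> (x \<oplus> y)"
      by (simp add: a_comm[of y] mult_invol)
    also have "\<dots> = y \<otimes> \<alpha> (x \<oplus> y) \<oplus> x \<otimes> \<alpha> (x \<oplus> y)"
      by (simp add: l_distr)
    finally have sum: "y \<otimes> \<alpha> (x \<oplus> y) \<oplus> x \<otimes> \<alpha> (x \<oplus> y) = \<zero>" ..
    \<comment> \<open>A summand lies below the sum, so a sum equal to \<open>\<zero>\<close> has
      only zero summands.\<close>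
    have "y \<otimes> \<alpha> (x \<oplus> y) \<preceq> \<zero>"
      using add_le[of "y \<otimes> \<alpha> (x \<oplus> y)" "x \<otimes> \<alpha> (x \<oplus> y)"] by (simp add: sum)
    then show ?thesis
      by (simp add: induced_le_def)
  qed
  finally show ?thesis
    by (simp add: invol_zero l_one)
qed

lemma meet_eq_mult:
  "\<lbrakk> x \<in> carrier R; y \<in> carrier R \<rbrakk> \<Longrightarrow> \<alpha> (\<alpha> x \<oplus> \<alpha> y) = \<alpha> (\<alpha> x \<otimes> y) \<otimes> y"
  using lukasiewicz_eq_invol_add[of "\<alpha> x" "\<alpha> y"] by (simp add: invol_invol)

lemma meet_of_le:
  "\<lbrakk> x \<in> carrier R; y \<in> carrier R; x \<preceq> y \<rbrakk> \<Longrightarrow> \<alpha> (\<alpha> x \<oplus> \<alpha> y) = x"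
  using invol_antitone[of x y] by (simp add: induced_le_def a_comm invol_invol)

text \<open>The left side is \<open>(x \<or> y') \<and> y\<close>, computed in
  \<open>lattice_of R\<close>.\<close>

lemma mult_eq_sasaki:
  assumes [simp]: "x \<in> carrier R" "y \<in> carrier R"
  shows "\<alpha> (\<alpha> (x \<oplus> \<alpha> y) \<oplus> \<alpha> y) = x \<otimes> y"
proof -
  have "\<alpha> (x \<oplus> \<alpha> y) \<otimes> y = \<alpha> (x \<otimes> y) \<otimes> y \<otimes> y"
    using meet_eq_mult[of "\<alpha> x" y] by (simp add: invol_invol)
  \<comment> \<open>The product \<open>\<alpha> (x \<otimes> y) \<otimes> y\<close> is already below
    \<open>y\<close>, so a further factor \<open>y\<close> changes nothing.\<close>
  also have "\<dots> = \<alpha> (x \<otimes> y) \<otimes> y"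
    by (simp add: mult_fixes mult_le)
  finally have "\<alpha> (\<alpha> (x \<oplus> \<alpha> y) \<oplus> \<alpha> y) = \<alpha> (\<alpha> (x \<otimes> y) \<otimes> y) \<otimes> y"
    by (simp add: meet_eq_mult)
  \<comment> \<open>Read backwards, the meet formula gives the meet of \<open>x \<otimes> y\<close>
    with \<open>y\<close>, and \<open>x \<otimes> y \<preceq> y\<close>.\<close>
  also have "\<dots> = x \<otimes> y"
    by (simp flip: meet_eq_mult add: meet_of_le mult_le)
  finally show ?thesis .
qed

lemma meet_invol:
  assumes [simp]: "x \<in> carrier R" shows "\<alpha> (\<alpha> x \<oplus> x) = \<zero>"
proof -
  have "\<alpha> (\<alpha> x \<oplus> x) = \<alpha> (\<alpha> x \<otimes> \<alpha> x) \<otimes> \<alpha> x"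
    using lukasiewicz_eq_invol_add[of "\<alpha> x" x] by simp
  also have "\<alpha> x \<otimes> \<alpha> x = \<alpha> x"
    by (simp add: mult_fixes induced_le_def add_idem)
  finally show ?thesis
    by (simp add: invol_invol mult_invol)
qed

text \<open>Since \<open>\<alpha> y \<preceq> \<alpha> x\<close>, the product
  \<open>\<alpha> y \<otimes> \<alpha> x\<close> is \<open>\<alpha> y\<close>. Writing it as a
  Sasaki projection and applying \<open>\<alpha>\<close> gives the law, with the meet of
  \<open>y\<close> and \<open>\<alpha> x\<close> expressed through \<open>\<oplus>\<close> and
  \<open>\<alpha>\<close>.\<close>

lemma orthomodular_law:
  assumes [simp]: "x \<in> carrier R" "y \<in> carrier R" and "x \<preceq> y"
  shows "y = x \<oplus> \<alpha> (\<alpha> y \<oplus> x)"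
proof -
  have "\<alpha> y \<otimes> \<alpha> x = \<alpha> y"
    using assms by (simp add: mult_fixes invol_antitone)
  then have "\<alpha> (\<alpha> (\<alpha> y \<oplus> x) \<oplus> x) = \<alpha> y"
    using mult_eq_sasaki[of "\<alpha> y" "\<alpha> x"] by (simp add: invol_invol)
  then have "\<alpha> (\<alpha> (\<alpha> (\<alpha> y \<oplus> x) \<oplus> x)) = \<alpha> (\<alpha> y)"
    by simp
  then show ?thesis
    by (simp add: invol_invol a_comm)
qed

end

theorem orthomodular_lattice_of:
  fixes R :: "'a inv_ring" (structure)
  assumes "orthomodular_near_semiring R"
  shows "orthomodular_lattice (lattice_of R)"
proof -
  interpret orthomodular_near_semiring R by fact
  show ?thesis
  proof (unfold_locales, unfold lattice_of_def lattice_le_def, simp_all)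
    fix x y assume [simp]: "x \<in> carrier R" "y \<in> carrier R"
    show "x \<oplus> \<alpha> (\<alpha> x \<oplus> \<alpha> y) = x"
      using invol_antitone[OF _ _ add_le[of "\<alpha> x" "\<alpha> y"]]
      by (simp add: induced_le_def invol_invol a_comm)
    show "\<alpha> (\<alpha> x \<oplus> \<alpha> (x \<oplus> y)) = x"
      by (simp add: meet_of_le add_le)
    show "\<alpha> y \<oplus> \<alpha> x = \<alpha> x" if "x \<oplus> y = y"
      using that invol_antitone[of x y] by (simp add: induced_le_def)
    show "y = x \<oplus> \<alpha> (\<alpha> y \<oplus> \<alpha> (\<alpha> x))" if "x \<oplus> y = y"
      using that orthomodular_law[of x y] by (simp add: induced_le_def invol_invol)
  next
    fix x assume [simp]: "x \<in> carrier R"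
    \<comment> \<open>The join law for complements is the image of \<open>meet_invol\<close> under
      \<open>\<alpha>\<close>.\<close>
    have "\<alpha> (\<alpha> (\<alpha> x \<oplus> x)) = \<alpha> \<zero>"
      by (simp add: meet_invol)
    then show "x \<oplus> \<alpha> x = \<one>"
      by (simp add: invol_invol invol_zero a_comm)
    show "\<alpha> (\<alpha> x \<oplus> \<alpha> (\<alpha> x)) = \<zero>"
      by (simp add: invol_invol meet_invol)
    show "x \<oplus> \<one> = \<one>"
      by (simp add: a_comm[of x] one_add)
  qed (simp_all add: a_ac invol_invol)
qed

theorem same_near_semiring_of_lattice_of:
  assumes "orthomodular_near_semiring R"
  shows "same_near_semiring R (near_semiring_of (lattice_of R))"
proof -
  interpret orthomodular_near_semiring R by fact
  show ?thesis
    by (simp add: same_near_semiring_def lattice_of_def near_semiring_of_def mult_eq_sasaki)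
qed

text \<open>Each half also asserts that the image satisfies the axioms of the other class, so the
  assignments really map between the two classes.\<close>

theorem theorem11:
  shows "(\<forall>L :: 'a ortholattice_alg. orthomodular_lattice L \<longrightarrow>
            orthomodular_near_semiring (near_semiring_of L) \<and>
            same_lattice L (lattice_of (near_semiring_of L))) \<and>
         (\<forall>R :: 'a inv_ring. orthomodular_near_semiring R \<longrightarrow>
            orthomodular_lattice (lattice_of R) \<and>
            same_near_semiring R (near_semiring_of (lattice_of R)))"
  using orthomodular_near_semiring_of same_lattice_of_near_semiring_of
    orthomodular_lattice_of same_near_semiring_of_lattice_of
  by blast

end
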